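(* Let $k\ge1$, $\alpha>-1$, and let $\bm{\beta}=(\beta_1,\ldots,\beta_k)$ with $\beta_j<0$ and $\beta_i\ne\beta_j$ whenever $i\neq j$. Then for all $\mathbf{n}=(n_1,\ldots,n_k)\in\mathbb{Z}_{\ge0}^k$ the multiple Laguerre polynomial of the second kind $L_{\mathbf{n}}^{(\alpha;\bm{\beta})}(x)$ and the multivariate Laguerre polynomial $L_{\mathbf{n}}^{(\alpha)}$ are related by $$L_{\mathbf{n}}^{(\alpha;\bm{\beta})}(x)=n_1!\cdots n_k!\;L_{\mathbf{n}}^{(\alpha)}(-\beta_1x,\ldots,-\beta_kx).$$
   Context: For $\mathbf{t}\in\mathbb{C}^k$: $\langle\mathbf{t}\rangle:=t_1+\cdots+t_k$, $\bm{\beta}\circ\mathbf{t}:=(\beta_1t_1,\ldots,\beta_kt_k)$, $\mathbf{t}^{\mathbf{n}}:=t_1^{n_1}\cdots t_k^{n_k}$, $\mathbf{n}!:=n_1!\cdots n_k!$. The multiple Laguerre polynomials of the second kind $L_{\mathbf{n}}^{(\alpha;\bm{\beta})}(x)$ (which satisfy $\int_0^\infty x^\ell L_{\mathbf{n}}^{(\alpha;\bm{\beta})}(x)x^\alpha \mathrm{e}^{\beta_jx}\,\mathrm{d}x=0$ for $\ell=0,\ldots,n_j-1$, $j=1,\ldots,k$) are normalized and defined by the generating function $$(1-\langle\mathbf{t}\rangle)^{-\alpha-1}\exp\left\{\frac{\langle\bm{\beta}\circ\mathbf{t}\rangle x}{1-\langle\mathbf{t}\rangle}\right\}=\sum_{\mathbf{n}\in\mathbb{Z}_{\ge0}^k}L_{\mathbf{n}}^{(\alpha;\bm{\beta})}(x)\frac{\mathbf{t}^{\mathbf{n}}}{\mathbf{n}!}.$$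 Erdélyi's multivariate Laguerre polynomials $L_{\mathbf{n}}^{(\alpha)}(\mathbf{x})$ are defined by $$(1-\langle\mathbf{z}\rangle)^{-\alpha-1}\exp\left\{-\frac{x_1z_1+\cdots+x_kz_k}{1-\langle\mathbf{z}\rangle}\right\}=\sum_{\mathbf{n}\in\mathbb{Z}_{\ge0}^k}L_{\mathbf{n}}^{(\alpha)}(\mathbf{x})\,\mathbf{z}^{\mathbf{n}},\qquad |z_1|+\cdots+|z_k|<1.$$ *)

theory Defs
  imports "HOL-Analysis.Analysis"
begin

text \<open>
  Multi-indices are vectors \<open>n :: nat ^ 'k\<close>; the number of variables is \<open>CARD('k)\<close>.
\<close>

definition vsum :: "complex ^ 'k::finite \<Rightarrow> complex" where
  "vsum t = (\<Sum>j\<in>UNIV. t $ j)"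

definition vhad :: "real ^ 'k::finite \<Rightarrow> complex ^ 'k \<Rightarrow> complex ^ 'k" where
  "vhad \<beta> t = (\<chi> j. of_real (\<beta> $ j) * t $ j)"

definition mpow :: "complex ^ 'k::finite \<Rightarrow> nat ^ 'k \<Rightarrow> complex" where
  "mpow t n = (\<Prod>j\<in>UNIV. (t $ j) ^ (n $ j))"

definition mfact :: "nat ^ 'k::finite \<Rightarrow> complex" where
  "mfact n = (\<Prod>j\<in>UNIV. fact (n $ j))"

text \<open>
  Both families are the unique coefficient families in the expansions of their generating
  functions. The generating function of the multiple Laguerre polynomials comes without an explicit
  domain, so its expansion is required in some neighbourhood of \<open>0\<close> (which may depend on \<open>x\<close>).
  Here \<open>powr\<close> is the principal branch, holomorphic where \<open>Re (vsum t) < 1\<close>; \<open>has_sum\<close>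
  is unconditional summation over all multi-indices.
\<close>

definition mult_laguerre2 ::
    "real \<Rightarrow> real ^ 'k::finite \<Rightarrow> nat ^ 'k \<Rightarrow> complex \<Rightarrow> complex" where
  "mult_laguerre2 \<alpha> \<beta> =
     (THE L. \<forall>x. \<forall>\<^sub>F t in nhds (0 :: complex ^ 'k).
        ((\<lambda>n. L n x * (mpow t n / mfact n)) has_sum
           ((1 - vsum t) powr of_real (- \<alpha> - 1)
              * exp (vsum (vhad \<beta> t) * x / (1 - vsum t)))) UNIV)"

definition erdelyi_laguerre ::
    "real \<Rightarrow> nat ^ 'k::finite \<Rightarrow> complex ^ 'k \<Rightarrow> complex" where
  "erdelyi_laguerre \<alpha> =
     (THE L. \<forall>x. \<forall>z :: complex ^ 'k. (\<Sum>j\<in>UNIV. norm (z $ j)) < 1 \<longrightarrow>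
        ((\<lambda>n. L n x * mpow z n) has_sum
           ((1 - vsum z) powr of_real (- \<alpha> - 1)
              * exp (- ((\<Sum>j\<in>UNIV. x $ j * z $ j) / (1 - vsum z))))) UNIV)"

end

theory Submission
  imports Defs
begin

text \<open>
  Specialising the variables of Erdelyi's generating function to
  \<open>x\<^sub>j = - \<beta>\<^sub>j x\<close> turns it into the generating function of the multiple Laguerre
  polynomials, so the two coefficient families agree up to the factor \<open>n!\<close>. Since both families
  are given by a definite description, this comparison needs two facts: that the generating
  function is an unconditionally convergent power series on the whole unit ball of the 1-norm
  (\<open>erdelyi_coeff_has_sum\<close>), and that the coefficients of a power series in several variables are
  determined by its sum near \<open>0\<close> (\<open>multi_powser_coeffs_unique\<close>).

  Existence. With \<open>s = z\<^sub>1 + \<dots> + z\<^sub>k\<close> and \<open>y = - (x\<^sub>1 z\<^sub>1 + \<dots> + x\<^sub>k z\<^sub>k)\<close>, the exponential series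
  followed by the binomial series gives
  \<open>(1 - s)\<close> to the power \<open>- \<alpha> - 1\<close> times \<open>exp (y / (1 - s))\<close> as the double series of
  \<open>c m p * y ^ m * s ^ p\<close>, where \<open>c m p\<close> is the coefficient \<open>laguerre_coeff \<alpha> m p\<close>, which is
  nonnegative for \<open>\<alpha> > -1\<close>. Multiplying out the powers \<open>y ^ m\<close> and \<open>s ^ p\<close> without collecting terms
  gives a sum over pairs of words of lengths \<open>m\<close> and \<open>p\<close> in the alphabet of variables. As all
  \<open>c m p\<close> are nonnegative, the sum of the absolute values is again a series of the same shape, with
  the values \<open>\<bar>x\<^sub>j z\<^sub>j\<bar>\<close> and \<open>\<bar>z\<^sub>j\<bar>\<close>, and so converges when \<open>\<bar>z\<^sub>1\<bar> + \<dots> + \<bar>z\<^sub>k\<bar> < 1\<close>. Hence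
  the pairs of words may be regrouped by the number of occurrences of each letter, which yields the
  monomials in \<open>z\<close>.

  Uniqueness. Along a monomial curve \<open>z\<^sub>j = \<lambda> ^ e\<^sub>j\<close> a power series in \<open>z\<close> becomes one in
  \<open>\<lambda>\<close>, whose coefficients collect the multi-indices of equal weight. The exponents can be chosen
  such that a given multi-index shares its weight only with multi-indices of smaller degree
  (\<open>exists_separating_weight\<close>), so induction on the degree isolates every coefficient.
\<close>

section \<open>Unconditional sums\<close>

text \<open>
  Fubini in the direction from iterated to joint sums: convergence of the iterated sum of the norms
  gives summability over the whole index set, after which the iterated sum has to be the joint one.
\<close>

lemma has_sum_Sigma_of_norms:
  fixes f :: "'a \<times> 'b \<Rightarrow> complex"
  assumes N: "\<And>x. x \<in> A \<Longrightarrow> ((\<lambda>y. norm (f (x, y))) has_sum N x) (B x)"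
    and T: "(N has_sum T) A"
    and g: "\<And>x. x \<in> A \<Longrightarrow> ((\<lambda>y. f (x, y)) has_sum g x) (B x)"
    and S: "(g has_sum S) A"
  shows "(f has_sum S) (Sigma A B)"
proof -
  have N_eq: "infsum (\<lambda>y. norm (f (x, y))) (B x) = N x" if "x \<in> A" for x
    using N[OF that] by (rule infsumI)
  have "N x \<ge> 0" if "x \<in> A" for x
    using N[OF that] by (rule has_sum_nonneg) auto
  then have "norm (infsum (\<lambda>y. norm (f (x, y))) (B x)) = N x" if "x \<in> A" for x
    using that by (simp add: N_eq)
  then have "(\<lambda>x. norm (infsum (\<lambda>y. norm (f (x, y))) (B x))) summable_on A"
    using has_sum_imp_summable[OF T] by (simp cong: summable_on_cong)
  then have abs: "(\<lambda>w. norm (f w)) summable_on Sigma A B"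
    unfolding Infinite_Sum.abs_summable_on_Sigma_iff
    using has_sum_imp_summable[OF N] by blast
  show "(f has_sum S) (Sigma A B)"
    using g S abs_summable_summable[OF abs] by (rule has_sum_SigmaI)
qed

lemma has_sum_group:
  fixes g :: "'a \<Rightarrow> complex"
  assumes "(g has_sum S) UNIV"
  shows "((\<lambda>n. infsum g {w. \<kappa> w = n}) has_sum S) UNIV"
proof (rule has_sum_SigmaD)
  have "bij_betw snd (SIGMA n:UNIV. {w. \<kappa> w = n}) UNIV"
    by (auto simp: bij_betw_def inj_on_def image_iff)
  from has_sum_reindex_bij_betw[OF this, of g S]
  show "((\<lambda>w. g (snd w)) has_sum S) (SIGMA n:UNIV. {w. \<kappa> w = n})"
    using assms by simp
next
  fix n
  have "g summable_on {w. \<kappa> w = n}"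
    using has_sum_imp_summable[OF assms] by (rule summable_on_subset_banach) auto
  then show "((\<lambda>y. g (snd (n, y))) has_sum infsum g {w. \<kappa> w = n}) {w. \<kappa> w = n}"
    by simp
qed

section \<open>Uniqueness of power series coefficients in several variables\<close>

lemma base_digits_unique:
  fixes f g :: "nat \<Rightarrow> nat"
  assumes "\<And>i. i < k \<Longrightarrow> f i < M" "\<And>i. i < k \<Longrightarrow> g i < M"
    and "(\<Sum>i<k. f i * M ^ i) = (\<Sum>i<k. g i * M ^ i)"
    and "i < k"
  shows "f i = g i"
  using assms
proof (induction k arbitrary: f g i)
  case (Suc k)
  have split: "(\<Sum>i<Suc k. h i * M ^ i) = h 0 + M * (\<Sum>i<k. h (Suc i) * M ^ i)" for h :: "nat \<Rightarrow> nat"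
    unfolding sum.lessThan_Suc_shift by (simp add: sum_distrib_left mult_ac)
  have eq: "f 0 + M * (\<Sum>i<k. f (Suc i) * M ^ i) = g 0 + M * (\<Sum>i<k. g (Suc i) * M ^ i)"
    using Suc.prems(3) unfolding split .
  have lt: "f 0 < M" "g 0 < M"
    using Suc.prems(1,2) by auto
  have head: "f 0 = g 0"
    using arg_cong[OF eq, of "\<lambda>x. x mod M"] lt by simp
  with eq lt have tail: "(\<Sum>i<k. f (Suc i) * M ^ i) = (\<Sum>i<k. g (Suc i) * M ^ i)"
    by simp
  show ?case
  proof (cases i)
    case (Suc j)
    then show ?thesis
      using Suc.IH[of "\<lambda>i. f (Suc i)" "\<lambda>i. g (Suc i)" j] tail Suc.prems by auto
  qed (use head in simp)
qed simp

definition mdeg :: "nat ^ 'k::finite \<Rightarrow> nat" where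
  "mdeg n = (\<Sum>j\<in>UNIV. n $ j)"

definition weight :: "('k::finite \<Rightarrow> nat) \<Rightarrow> nat ^ 'k \<Rightarrow> nat" where
  "weight e n = (\<Sum>j\<in>UNIV. e j * n $ j)"

text \<open>
  The Kronecker substitution \<open>e j = M ^ h j\<close>, with \<open>h\<close> an enumeration of the variables and \<open>M\<close>
  larger than the degree of \<open>n\<close>, separates the multi-indices of that degree by uniqueness of
  digits in base \<open>M\<close>. Adding a large constant \<open>B\<close> to every exponent makes the degree dominate,
  so that multi-indices of larger degree get larger weight.
\<close>

lemma exists_separating_weight:
  fixes n :: "nat ^ 'k::finite"
  shows "\<exists>e. (\<forall>j. 0 < e j) \<and> (\<forall>m. mdeg n \<le> mdeg m \<longrightarrow> weight e m = weight e n \<longrightarrow> m = n)"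
proof -
  obtain h where h: "bij_betw h (UNIV :: 'k set) {0..<CARD('k)}"
    using ex_bij_betw_finite_nat[OF finite_class.finite_UNIV] by blast
  define M where "M = Suc (mdeg n)"
  define low where "low m = (\<Sum>j\<in>UNIV. m $ j * M ^ h j)" for m :: "nat ^ 'k"
  define B where "B = Suc (low n)"
  define e where "e j = B + M ^ h j" for j
  have weight_eq: "weight e m = B * mdeg m + low m" for m
    by (simp add: weight_def e_def mdeg_def low_def algebra_simps sum.distrib sum_distrib_left)
  have "m = n" if deg: "mdeg n \<le> mdeg m" and w: "weight e m = weight e n" for m
  proof -
    have deg_eq: "mdeg m = mdeg n"
    proof (rule ccontr)
      assume "mdeg m \<noteq> mdeg n"
      with deg have "B * Suc (mdeg n) \<le> B * mdeg m"
        by (intro mult_le_mono2) simp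
      with w show False
        unfolding weight_eq by (simp add: B_def)
    qed
    with w have low_eq: "low m = low n"
      unfolding weight_eq by simp
    have low_digits: "low m = (\<Sum>i<CARD('k). m $ inv h i * M ^ i)" for m
    proof -
      have "low m = (\<Sum>j\<in>UNIV. (\<lambda>i. m $ inv h i * M ^ i) (h j))"
        using bij_betw_imp_inj_on[OF h] by (simp add: low_def)
      also have "\<dots> = (\<Sum>i<CARD('k). m $ inv h i * M ^ i)"
        using sum.reindex_bij_betw[OF h, of "\<lambda>i. m $ inv h i * M ^ i"]
        unfolding atLeast0LessThan .
      finally show ?thesis .
    qed
    have digit: "m' $ j < M" if "mdeg m' = mdeg n" for m' :: "nat ^ 'k" and j
      using that member_le_sum[of j UNIV "($) m'"] by (simp add: M_def mdeg_def)
    show "m = n"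
    proof (rule vec_eq_iff[THEN iffD2], rule allI)
      fix j
      have "h j < CARD('k)"
        using bij_betwE[OF h] by auto
      then have "m $ inv h (h j) = n $ inv h (h j)"
        using base_digits_unique[of "CARD('k)" "\<lambda>i. m $ inv h i" M "\<lambda>i. n $ inv h i" "h j"]
          digit[OF deg_eq] digit[OF refl] low_eq low_digits by simp
      then show "m $ j = n $ j"
        using bij_betw_imp_inj_on[OF h] by simp
    qed
  qed
  then show ?thesis
    by (intro exI[of _ e]) (auto simp: e_def B_def)
qed

lemma powser_coeffs_zero:
  fixes b :: "nat \<Rightarrow> complex"
  assumes "\<forall>\<^sub>F x in nhds 0. (\<lambda>d. b d * x ^ d) sums 0"
  shows "b d = 0"
proof -
  obtain r where r: "r > 0" "\<And>x. dist x 0 < r \<Longrightarrow> (\<lambda>d. b d * x ^ d) sums 0"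
    using assms unfolding eventually_nhds_metric by blast
  have "(\<lambda>d. b d * of_real (r / 2) ^ d) sums 0"
    using r by (intro r) simp
  then have "conv_radius b \<ge> norm (of_real (r / 2) :: complex)"
    by (intro conv_radius_geI sums_summable)
  moreover have "ereal (norm (of_real (r / 2) :: complex)) > 0"
    using r(1) by simp
  ultimately have "conv_radius b > 0"
    by (rule less_le_trans[rotated])
  then have "fps_conv_radius (Abs_fps b) > 0"
    by (simp add: fps_conv_radius_def)
  moreover have "\<forall>\<^sub>F x in nhds 0. eval_fps (Abs_fps b) x = eval_fps 0 x"
    using assms by eventually_elim (simp add: eval_fps_def sums_iff)
  ultimately have "Abs_fps b = 0"
    by (intro eval_fps_eqD) auto
  then show ?thesis
    by (metis fps_nth_Abs_fps fps_zero_nth)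
qed

lemma mpow_curve: "mpow (\<chi> j. x ^ e j) n = x ^ weight e n"
  by (simp add: mpow_def weight_def power_mult power_sum)

text \<open>
  Along the curve with exponents \<open>e\<close>, the coefficient of \<open>x ^ weight e n\<close> is the sum of \<open>a m\<close> over
  all \<open>m\<close> with the weight of \<open>n\<close>. For a separating weight every such \<open>m\<close> other than \<open>n\<close> has smaller
  degree, hence contributes \<open>0\<close> by induction. Positivity of the exponents is what makes the curve
  pass through the origin.
\<close>

theorem multi_powser_coeffs_zero:
  fixes a :: "nat ^ 'k::finite \<Rightarrow> complex"
  assumes "\<forall>\<^sub>F t in nhds 0. ((\<lambda>n. a n * mpow t n) has_sum 0) UNIV"
  shows "a n = 0"
proof (induction "mdeg n" arbitrary: n rule: less_induct)
  case less
  obtain e where e: "\<And>j. 0 < e j"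
    and sep: "\<And>m. mdeg n \<le> mdeg m \<Longrightarrow> weight e m = weight e n \<Longrightarrow> m = n"
    using exists_separating_weight[of n] by blast
  define b where "b d = infsum a {m. weight e m = d}" for d
  define \<gamma> :: "complex \<Rightarrow> complex ^ 'k" where "\<gamma> x = (\<chi> j. x ^ e j)" for x
  have "(\<gamma> \<longlongrightarrow> 0) (nhds 0)"
  proof (rule vec_tendstoI)
    fix j
    have "((\<lambda>x::complex. x ^ e j) \<longlongrightarrow> 0 ^ e j) (nhds 0)"
      by (intro tendsto_power filterlim_ident)
    then show "((\<lambda>x. \<gamma> x $ j) \<longlongrightarrow> 0 $ j) (nhds 0)"
      using e[of j] by (simp add: \<gamma>_def power_0_left)
  qed
  with assms have "\<forall>\<^sub>F x in nhds 0. ((\<lambda>m. a m * mpow (\<gamma> x) m) has_sum 0) UNIV"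
    by (rule eventually_compose_filterlim)
  then have "\<forall>\<^sub>F x in nhds 0. (\<lambda>d. b d * x ^ d) sums 0"
  proof eventually_elim
    case (elim x)
    have "infsum (\<lambda>m. a m * mpow (\<gamma> x) m) {m. weight e m = d} = b d * x ^ d" for d
    proof -
      have "infsum (\<lambda>m. a m * mpow (\<gamma> x) m) {m. weight e m = d}
          = infsum (\<lambda>m. a m * x ^ d) {m. weight e m = d}"
        by (intro infsum_cong) (auto simp: \<gamma>_def mpow_curve)
      then show ?thesis
        by (simp add: b_def infsum_cmult_left')
    qed
    then show ?case
      using has_sum_imp_sums[OF has_sum_group[OF elim, of "weight e"]] by simp
  qed
  then have "b (weight e n) = 0"
    by (rule powser_coeffs_zero)
  moreover have "b (weight e n) = infsum a {n}"
    unfolding b_def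
  proof (rule infsum_cong_neutral)
    fix m assume "m \<in> {m. weight e m = weight e n} - {n}"
    then have "mdeg m < mdeg n"
      using sep[of m] by (cases "mdeg m < mdeg n") auto
    then show "a m = 0"
      by (rule less)
  qed auto
  ultimately show "a n = 0"
    by simp
qed

corollary multi_powser_coeffs_unique:
  fixes a b :: "nat ^ 'k::finite \<Rightarrow> complex"
  assumes "\<forall>\<^sub>F t in nhds 0. ((\<lambda>n. a n * mpow t n) has_sum F t) UNIV"
    and "\<forall>\<^sub>F t in nhds 0. ((\<lambda>n. b n * mpow t n) has_sum F t) UNIV"
  shows "a = b"
proof
  fix n
  have "\<forall>\<^sub>F t in nhds 0. ((\<lambda>n. (a n - b n) * mpow t n) has_sum 0) UNIV"
    using assms
  proof eventually_elim
    case (elim t)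
    then show ?case
      using has_sum_add[OF elim(1) has_sum_uminusI[OF elim(2)]]
      by (simp add: left_diff_distrib)
  qed
  then have "a n - b n = 0"
    by (rule multi_powser_coeffs_zero)
  then show "a n = b n"
    by simp
qed

lemma eventually_l1_ball: "\<forall>\<^sub>F t in nhds (0 :: complex ^ 'k::finite). (\<Sum>j\<in>UNIV. norm (t $ j)) < 1"
proof -
  have "((\<lambda>t :: complex ^ 'k. \<Sum>j\<in>UNIV. norm (t $ j)) \<longlongrightarrow> (\<Sum>j\<in>UNIV. norm ((0 :: complex ^ 'k) $ j))) (nhds 0)"
    by (intro tendsto_intros filterlim_ident)
  then show ?thesis
    by (rule order_tendstoD(2)) simp
qed

section \<open>The Laguerre generating function as a double series\<close>

text \<open>
  The number \<open>laguerre_coeff \<alpha> m p\<close> is the coefficient of \<open>y ^ m * s ^ p\<close> in the generating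
  function: \<open>1 / m!\<close> from the exponential series times the binomial coefficient of \<open>s ^ p\<close> in
  \<open>(1 - s)\<close> to the power \<open>- (\<alpha> + 1 + m)\<close>.
\<close>

definition laguerre_coeff :: "real \<Rightarrow> nat \<Rightarrow> nat \<Rightarrow> real" where
  "laguerre_coeff \<alpha> m p = pochhammer (\<alpha> + 1 + real m) p / (fact m * fact p)"

lemma laguerre_coeff_nonneg: "\<alpha> > -1 \<Longrightarrow> laguerre_coeff \<alpha> m p \<ge> 0"
  unfolding laguerre_coeff_def by (intro divide_nonneg_pos pochhammer_nonneg) auto

lemma pochhammer_sums_real:
  fixes c r :: real
  assumes "\<bar>r\<bar> < 1"
  shows "(\<lambda>p. pochhammer c p / fact p * r ^ p) sums (1 - r) powr (- c)"
proof -
  have "(- c gchoose p) * (- r) ^ p = pochhammer c p / fact p * r ^ p" for p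
    by (simp add: gbinomial_pochhammer uminus_power_if)
  then show ?thesis
    using gen_binomial_real[of "- r" "- c"] assms by simp
qed

lemma pochhammer_sums_complex:
  fixes c s :: complex
  assumes "norm s < 1"
  shows "(\<lambda>p. pochhammer c p / fact p * s ^ p) sums (1 - s) powr (- c)"
proof -
  have "(- c gchoose p) * (- s) ^ p = pochhammer c p / fact p * s ^ p" for p
    by (simp add: gbinomial_pochhammer uminus_power_if)
  then show ?thesis
    using gen_binomial_complex[of "- s" "- c"] assms by simp
qed

lemma laguerre_inner_real:
  assumes "\<alpha> > -1" "0 \<le> r" "r < 1" "0 \<le> Y"
  shows "((\<lambda>p. laguerre_coeff \<alpha> m p * Y ^ m * r ^ p) has_sum
           (1 - r) powr (- \<alpha> - 1) * ((Y / (1 - r)) ^ m /\<^sub>R fact m)) UNIV"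
proof (rule sums_nonneg_imp_has_sum)
  have "(1 - r) powr (- (\<alpha> + 1 + real m)) = (1 - r) powr (- \<alpha> - 1) / (1 - r) ^ m"
    using assms by (simp add: powr_diff powr_minus powr_add powr_realpow divide_simps)
  then have "(\<lambda>p. Y ^ m / fact m * (pochhammer (\<alpha> + 1 + real m) p / fact p * r ^ p)) sums
      (Y ^ m / fact m * ((1 - r) powr (- \<alpha> - 1) / (1 - r) ^ m))"
    using sums_mult[OF pochhammer_sums_real[of r "\<alpha> + 1 + real m"], of "Y ^ m / fact m"] assms
    by simp
  then show "(\<lambda>p. laguerre_coeff \<alpha> m p * Y ^ m * r ^ p) sums
      ((1 - r) powr (- \<alpha> - 1) * ((Y / (1 - r)) ^ m /\<^sub>R fact m))"
    by (simp add: laguerre_coeff_def field_simps)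
qed (use assms laguerre_coeff_nonneg in auto)

lemma laguerre_inner_complex:
  fixes y s :: complex
  assumes "\<alpha> > -1" "norm s < 1"
  shows "((\<lambda>p. of_real (laguerre_coeff \<alpha> m p) * y ^ m * s ^ p) has_sum
           (1 - s) powr of_real (- \<alpha> - 1) * ((y / (1 - s)) ^ m /\<^sub>R fact m)) UNIV"
proof (rule norm_summable_imp_has_sum)
  show "summable (\<lambda>p. norm (of_real (laguerre_coeff \<alpha> m p) * y ^ m * s ^ p))"
    using has_sum_imp_sums[OF laguerre_inner_real[of \<alpha> "norm s" "norm y" m]] assms
    by (simp add: norm_mult norm_power laguerre_coeff_nonneg sums_iff)
  have "s \<noteq> 1"
    using assms by auto
  moreover have "- (of_real \<alpha> + 1 + of_nat m) = of_real (- \<alpha> - 1) - (of_nat m :: complex)"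
    by simp
  ultimately have "(1 - s) powr (- (of_real \<alpha> + 1 + of_nat m)) = (1 - s) powr (of_real (- \<alpha> - 1)) / (1 - s) ^ m"
    by (simp only: powr_diff powr_nat' diff_eq_eq) simp
  then have "(\<lambda>p. y ^ m / fact m * (pochhammer (of_real \<alpha> + 1 + of_nat m) p / fact p * s ^ p)) sums
      (y ^ m / fact m * ((1 - s) powr of_real (- \<alpha> - 1) / (1 - s) ^ m))"
    using sums_mult[OF pochhammer_sums_complex[of s "of_real \<alpha> + 1 + of_nat m"], of "y ^ m / fact m"] assms
    by simp
  moreover have "pochhammer (of_real \<alpha> + 1 + of_nat m :: complex) p = of_real (pochhammer (\<alpha> + 1 + real m) p)" for p
    by (simp flip: pochhammer_of_real)
  ultimately show "(\<lambda>p. of_real (laguerre_coeff \<alpha> m p) * y ^ m * s ^ p) sums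
      ((1 - s) powr of_real (- \<alpha> - 1) * ((y / (1 - s)) ^ m /\<^sub>R fact m))"
    by (simp add: laguerre_coeff_def field_simps scaleR_conv_of_real)
qed

lemma exp_has_sum: "((\<lambda>m. w ^ m /\<^sub>R fact m) has_sum exp w) UNIV"
  for w :: "'a::{real_normed_field,banach}"
  by (intro norm_summable_imp_has_sum exp_converges summable_norm_exp)

text \<open>
  Nonnegativity of the coefficients makes the majorant the same series at \<open>norm y\<close> and
  \<open>norm s\<close>, so its convergence is the real case of the computation of the sum.
\<close>

lemma laguerre_double_series:
  fixes y s :: complex
  assumes "\<alpha> > -1" "norm s < 1"
  shows "((\<lambda>(m, p). of_real (laguerre_coeff \<alpha> m p) * y ^ m * s ^ p) has_sum
            (1 - s) powr of_real (- \<alpha> - 1) * exp (y / (1 - s))) UNIV"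
proof -
  have "((\<lambda>(m, p). of_real (laguerre_coeff \<alpha> m p) * y ^ m * s ^ p) has_sum
            (1 - s) powr of_real (- \<alpha> - 1) * exp (y / (1 - s))) (UNIV \<times> UNIV)"
  proof (rule has_sum_Sigma_of_norms)
    fix m
    show "((\<lambda>p. norm (case (m, p) of (m, p) \<Rightarrow> of_real (laguerre_coeff \<alpha> m p) * y ^ m * s ^ p)) has_sum
        (1 - norm s) powr (- \<alpha> - 1) * ((norm y / (1 - norm s)) ^ m /\<^sub>R fact m)) UNIV"
      using laguerre_inner_real[of \<alpha> "norm s" "norm y" m] assms
      by (simp add: norm_mult norm_power laguerre_coeff_nonneg)
    show "((\<lambda>p. case (m, p) of (m, p) \<Rightarrow> of_real (laguerre_coeff \<alpha> m p) * y ^ m * s ^ p) has_sum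
        (1 - s) powr of_real (- \<alpha> - 1) * ((y / (1 - s)) ^ m /\<^sub>R fact m)) UNIV"
      using laguerre_inner_complex assms by simp
  qed (rule has_sum_cmult_right, rule exp_has_sum)+
  then show ?thesis
    by simp
qed

section \<open>Expansion over pairs of words\<close>

lemma sum_power_eq_sum_words:
  fixes f :: "'k::finite \<Rightarrow> 'a::comm_semiring_1"
  shows "(\<Sum>j\<in>UNIV. f j) ^ m = (\<Sum>u | length u = m. prod_list (map f u))"
proof (induction m)
  case (Suc m)
  have "(\<Sum>u | length u = Suc m. prod_list (map f u))
      = (\<Sum>(a, u)\<in>UNIV \<times> {u. length u = m}. prod_list (map f (a # u)))"
    by (rule sum.reindex_bij_witness[of _ "\<lambda>(a, u). a # u" "\<lambda>u. (hd u, tl u)"])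
       (auto simp: length_Suc_conv)
  also have "\<dots> = (\<Sum>j\<in>UNIV. f j) * (\<Sum>u | length u = m. prod_list (map f u))"
    by (simp add: sum_product sum.cartesian_product)
  finally show ?case
    by (simp add: Suc.IH)
qed simp

lemma sum_words_product:
  fixes f h :: "'k::finite \<Rightarrow> 'a::comm_semiring_1"
  shows "c * (\<Sum>j\<in>UNIV. f j) ^ m * (\<Sum>j\<in>UNIV. h j) ^ p
    = (\<Sum>(u, v)\<in>{u. length u = m} \<times> {v. length v = p}. c * prod_list (map f u) * prod_list (map h v))"
  unfolding sum_power_eq_sum_words mult.assoc sum_product sum.cartesian_product
  by (simp add: sum_distrib_left case_prod_unfold)

text \<open>
  The two words of a term record the factors chosen when the powers of \<open>y\<close> and of \<open>s\<close>, two sums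
  over the variables, are multiplied out.
\<close>

definition word_term :: "real \<Rightarrow> ('k \<Rightarrow> complex) \<Rightarrow> ('k \<Rightarrow> complex) \<Rightarrow> 'k list \<times> 'k list \<Rightarrow> complex" where
  "word_term \<alpha> f h = (\<lambda>(u, v). of_real (laguerre_coeff \<alpha> (length u) (length v))
     * prod_list (map f u) * prod_list (map h v))"

lemma norm_prod_list_map: "norm (prod_list (map f u)) = prod_list (map (\<lambda>j. norm (f j)) u)"
  for f :: "'k \<Rightarrow> complex"
  by (induction u) (auto simp: norm_mult)

text \<open>
  The words of given lengths form finite fibres over the double series. The norms of the terms sum
  up to the double series at \<open>\<Sum>j. norm (f j)\<close> and \<open>\<Sum>j. norm (h j)\<close>; this is where the bound
  on the 1-norm of \<open>h\<close>, rather than on the sum of its values, enters.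
\<close>

lemma laguerre_word_series:
  fixes f h :: "'k::finite \<Rightarrow> complex"
  assumes \<alpha>: "\<alpha> > -1" and h: "(\<Sum>j\<in>UNIV. norm (h j)) < 1"
  shows "(word_term \<alpha> f h has_sum
    (1 - (\<Sum>j\<in>UNIV. h j)) powr of_real (- \<alpha> - 1)
      * exp ((\<Sum>j\<in>UNIV. f j) / (1 - (\<Sum>j\<in>UNIV. h j)))) UNIV"
    (is "(_ has_sum ?F) _")
proof -
  define W :: "nat \<times> nat \<Rightarrow> ('k list \<times> 'k list) set"
    where "W = (\<lambda>(m, p). {u. length u = m} \<times> {v. length v = p})"
  let ?f = "\<Sum>j\<in>UNIV. f j" and ?h = "\<Sum>j\<in>UNIV. h j"
  let ?nf = "\<Sum>j\<in>UNIV. norm (f j)" and ?nh = "\<Sum>j\<in>UNIV. norm (h j)"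
  have fin: "finite {u :: 'k list. length u = m}" for m
    using finite_lists_length_eq[of "UNIV :: 'k set" m] by simp
  have f0: "?nf \<ge> 0" and h0: "?nh \<ge> 0"
    by (intro sum_nonneg; simp)+
  have "((\<lambda>(x, w). word_term \<alpha> f h w) has_sum ?F) (Sigma UNIV W)"
  proof (rule has_sum_Sigma_of_norms)
    fix x :: "nat \<times> nat"
    obtain m p where x: "x = (m, p)" by force
    have finW: "finite (W x)"
      by (simp add: W_def x fin)
    show "((\<lambda>w. norm (case (x, w) of (x, w) \<Rightarrow> word_term \<alpha> f h w)) has_sum
        (case x of (m, p) \<Rightarrow> laguerre_coeff \<alpha> m p * ?nf ^ m * ?nh ^ p)) (W x)"
      by (intro has_sum_finiteI[OF finW])
        (use \<alpha> in \<open>auto simp: W_def x sum_words_product word_term_def norm_mult norm_prod_list_map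
           laguerre_coeff_nonneg intro!: sum.cong\<close>)
    show "((\<lambda>w. case (x, w) of (x, w) \<Rightarrow> word_term \<alpha> f h w) has_sum
        (case x of (m, p) \<Rightarrow> of_real (laguerre_coeff \<alpha> m p) * ?f ^ m * ?h ^ p)) (W x)"
      by (intro has_sum_finiteI[OF finW])
        (auto simp: W_def x sum_words_product word_term_def intro!: sum.cong)
  next
    have "(\<lambda>(m, p). of_real (laguerre_coeff \<alpha> m p) * of_real ?nf ^ m * of_real ?nh ^ p :: complex) summable_on UNIV"
      using \<alpha> h h0
      by (intro has_sum_imp_summable[OF laguerre_double_series])
        (simp_all del: of_real_sum)
    then have "(\<lambda>(m, p). laguerre_coeff \<alpha> m p * ?nf ^ m * ?nh ^ p) summable_on UNIV"
      unfolding summable_on_iff_abs_summable_on_complex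
      using \<alpha> h0 f0 by (simp add: case_prod_unfold norm_mult norm_power laguerre_coeff_nonneg del: of_real_sum)
    then show "((\<lambda>(m, p). laguerre_coeff \<alpha> m p * ?nf ^ m * ?nh ^ p) has_sum
        infsum (\<lambda>(m, p). laguerre_coeff \<alpha> m p * ?nf ^ m * ?nh ^ p) UNIV) UNIV"
      by simp
  next
    show "((\<lambda>(m, p). of_real (laguerre_coeff \<alpha> m p) * ?f ^ m * ?h ^ p) has_sum ?F) UNIV"
      using norm_sum[of h UNIV] h \<alpha> by (intro laguerre_double_series) auto
  qed
  moreover have "bij_betw snd (Sigma UNIV W) UNIV"
    by (auto simp: bij_betw_def inj_on_def image_iff W_def)
  ultimately show ?thesis
    using has_sum_reindex_bij_betw[of snd "Sigma UNIV W" UNIV "word_term \<alpha> f h" ?F]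
    by (simp add: case_prod_unfold)
qed

definition letter_counts :: "'k::finite list \<Rightarrow> nat ^ 'k" where
  "letter_counts w = (\<chi> j. count_list w j)"

lemma mpow_letter_counts: "mpow z (letter_counts w) = prod_list (map (($) z) w)"
proof (induction w)
  case (Cons a w)
  have "mpow z (letter_counts (a # w)) = (\<Prod>j\<in>UNIV. (if j = a then z $ j else 1) * (z $ j) ^ count_list w j)"
    unfolding mpow_def letter_counts_def by (intro prod.cong) auto
  also have "\<dots> = z $ a * mpow z (letter_counts w)"
    by (simp add: prod.distrib mpow_def letter_counts_def)
  finally show ?case
    by (simp add: Cons.IH)
qed (simp add: mpow_def letter_counts_def)

text \<open>
  The coefficient of \<open>z\<close> to the power \<open>n\<close> collects all pairs of words that together contain the
  letter \<open>j\<close> exactly \<open>n $ j\<close> times. The index set is finite, as the lengths of the two words add up to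
  the degree of \<open>n\<close>, so the value is a polynomial in \<open>x\<close>.
\<close>

definition erdelyi_coeff :: "real \<Rightarrow> nat ^ 'k::finite \<Rightarrow> complex ^ 'k \<Rightarrow> complex" where
  "erdelyi_coeff \<alpha> n x = infsum (word_term \<alpha> (\<lambda>j. - (x $ j)) (\<lambda>_. 1)) {(u, v). letter_counts (u @ v) = n}"

lemma prod_list_map_mult:
  "prod_list (map (\<lambda>j. f j * g j) u) = prod_list (map f u) * prod_list (map g u)"
  for f g :: "'k \<Rightarrow> 'a::comm_monoid_mult"
  by (induction u) (auto simp: mult_ac)

text \<open>
  A pair of words \<open>(u, v)\<close> contributes the monomial of the concatenation \<open>u @ v\<close> with a factor that
  does not depend on \<open>z\<close>, so grouping the word series by letter counts is a power series in \<open>z\<close>.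
\<close>

lemma erdelyi_coeff_has_sum:
  fixes x z :: "complex ^ 'k::finite"
  assumes "\<alpha> > -1" and z: "(\<Sum>j\<in>UNIV. norm (z $ j)) < 1"
  shows "((\<lambda>n. erdelyi_coeff \<alpha> n x * mpow z n) has_sum
           ((1 - vsum z) powr of_real (- \<alpha> - 1)
              * exp (- ((\<Sum>j\<in>UNIV. x $ j * z $ j) / (1 - vsum z))))) UNIV"
proof -
  let ?g = "word_term \<alpha> (\<lambda>j. - (x $ j) * z $ j) (($) z)"
  have "infsum ?g {w. (case w of (u, v) \<Rightarrow> letter_counts (u @ v)) = n} = erdelyi_coeff \<alpha> n x * mpow z n" for n
  proof -
    have "infsum ?g {w. (case w of (u, v) \<Rightarrow> letter_counts (u @ v)) = n}
        = infsum (\<lambda>w. word_term \<alpha> (\<lambda>j. - (x $ j)) (\<lambda>_. 1) w * mpow z n) {(u, v). letter_counts (u @ v) = n}"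
    proof (rule infsum_cong_neutral; clarsimp)
      fix u v assume "n = letter_counts (u @ v)"
      show "word_term \<alpha> (\<lambda>j. - (x $ j * z $ j)) (($) z) (u, v)
          = word_term \<alpha> (\<lambda>j. - (x $ j)) (\<lambda>_. 1) (u, v) * mpow z (letter_counts (u @ v))"
        using prod_list_map_mult[of "\<lambda>j. - (x $ j)" "($) z" u]
        by (simp add: word_term_def mpow_letter_counts map_replicate_const)
    qed
    then show ?thesis
      by (simp add: erdelyi_coeff_def infsum_cmult_left')
  qed
  moreover have "((\<lambda>n. infsum ?g {w. (case w of (u, v) \<Rightarrow> letter_counts (u @ v)) = n}) has_sum
      ((1 - vsum z) powr of_real (- \<alpha> - 1)
         * exp (- ((\<Sum>j\<in>UNIV. x $ j * z $ j) / (1 - vsum z))))) UNIV"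
    using laguerre_word_series[OF assms, of "\<lambda>j. - (x $ j) * z $ j"]
    by (intro has_sum_group) (simp add: vsum_def sum_negf)
  ultimately show ?thesis
    by simp
qed

section \<open>Identification of the two families\<close>

lemma erdelyi_laguerre_eq:
  fixes \<alpha> :: real
  assumes "\<alpha> > -1"
  shows "erdelyi_laguerre \<alpha> = (erdelyi_coeff \<alpha> :: nat ^ 'k::finite \<Rightarrow> _)"
  unfolding erdelyi_laguerre_def
proof (rule the_equality)
  show "\<forall>x. \<forall>z :: complex ^ 'k. (\<Sum>j\<in>UNIV. norm (z $ j)) < 1 \<longrightarrow>
        ((\<lambda>n. erdelyi_coeff \<alpha> n x * mpow z n) has_sum
           ((1 - vsum z) powr of_real (- \<alpha> - 1)
              * exp (- ((\<Sum>j\<in>UNIV. x $ j * z $ j) / (1 - vsum z))))) UNIV"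
    using erdelyi_coeff_has_sum[OF assms] by blast
next
  fix L :: "nat ^ 'k \<Rightarrow> complex ^ 'k \<Rightarrow> complex"
  assume L: "\<forall>x. \<forall>z :: complex ^ 'k. (\<Sum>j\<in>UNIV. norm (z $ j)) < 1 \<longrightarrow>
        ((\<lambda>n. L n x * mpow z n) has_sum
           ((1 - vsum z) powr of_real (- \<alpha> - 1)
              * exp (- ((\<Sum>j\<in>UNIV. x $ j * z $ j) / (1 - vsum z))))) UNIV"
  have eq: "(\<lambda>n. L n x) = (\<lambda>n. erdelyi_coeff \<alpha> n x)" for x
    by (rule multi_powser_coeffs_unique;
        rule eventually_mono[OF eventually_l1_ball])
       (use L erdelyi_coeff_has_sum[OF assms] in blast)+
  show "L = erdelyi_coeff \<alpha>"
    by (intro ext) (use eq in \<open>rule fun_cong\<close>)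
qed

lemma mfact_nonzero: "mfact n \<noteq> 0"
  by (simp add: mfact_def)

text \<open>
  The neighbourhood of \<open>0\<close> in the definition may be taken to be the unit ball of the 1-norm for
  every \<open>x\<close>; uniqueness applies to the coefficients divided by the nonzero factorials.
\<close>

lemma mult_laguerre2_eq:
  fixes \<beta> :: "real ^ 'k::finite"
  assumes "\<alpha> > -1"
  shows "mult_laguerre2 \<alpha> \<beta> = (\<lambda>n x. mfact n * erdelyi_coeff \<alpha> n (\<chi> j. - of_real (\<beta> $ j) * x))"
  unfolding mult_laguerre2_def
proof (rule the_equality)
  let ?M = "\<lambda>n x. mfact n * erdelyi_coeff \<alpha> n (\<chi> j. - of_real (\<beta> $ j) * x)"
  let ?G = "\<lambda>x t. (1 - vsum t) powr of_real (- \<alpha> - 1) * exp (vsum (vhad \<beta> t) * x / (1 - vsum t))"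
  have M: "\<forall>\<^sub>F t in nhds 0. ((\<lambda>n. ?M n x * (mpow t n / mfact n)) has_sum ?G x t) UNIV" for x
    using eventually_l1_ball
  proof eventually_elim
    case (elim t)
    let ?x = "\<chi> j. - of_real (\<beta> $ j) * x"
    have exponent: "- ((\<Sum>j\<in>UNIV. ?x $ j * t $ j) / (1 - vsum t))
        = vsum (vhad \<beta> t) * x / (1 - vsum t)"
      by (simp add: vsum_def vhad_def sum_negf sum_distrib_left mult_ac)
    have coeff: "(\<lambda>n. ?M n x * (mpow t n / mfact n)) = (\<lambda>n. erdelyi_coeff \<alpha> n ?x * mpow t n)"
      by (simp add: mfact_nonzero)
    show ?case
      unfolding coeff exponent[symmetric] by (rule erdelyi_coeff_has_sum[OF assms elim])
  qed
  then show "\<forall>x. \<forall>\<^sub>F t in nhds 0. ((\<lambda>n. ?M n x * (mpow t n / mfact n)) has_sum ?G x t) UNIV"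
    by blast
  fix L
  assume L: "\<forall>x. \<forall>\<^sub>F t in nhds 0. ((\<lambda>n. L n x * (mpow t n / mfact n)) has_sum ?G x t) UNIV"
  have eq: "(\<lambda>n. L n x / mfact n) = (\<lambda>n. ?M n x / mfact n)" for x
    by (rule multi_powser_coeffs_unique[of _ "?G x"]) (use L M[of x] in \<open>simp_all only: times_divide_eq_left times_divide_eq_right\<close>)
  show "L = ?M"
  proof (intro ext)
    fix n x
    show "L n x = ?M n x"
      using fun_cong[OF eq[of x], of n] by (simp add: mfact_nonzero field_simps)
  qed
qed

theorem mainTheorem6:
  fixes \<alpha> :: real and \<beta> :: "real ^ 'k::finite" and n :: "nat ^ 'k" and x :: complex
  assumes "\<alpha> > -1"
    and "\<And>j. \<beta> $ j < 0"
    and "\<And>i j. i \<noteq> j \<Longrightarrow> \<beta> $ i \<noteq> \<beta> $ j"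
  shows "mult_laguerre2 \<alpha> \<beta> n x
           = mfact n * erdelyi_laguerre \<alpha> n (\<chi> j. - of_real (\<beta> $ j) * x)"
  by (simp only: mult_laguerre2_eq[OF assms(1)] erdelyi_laguerre_eq[OF assms(1)])

end
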